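(* The symmetric group $S_3$ is generated by a right generalized Smarandache palindromic permutation and a left generalized Smarandache palindromic permutation; that is, there exist $\sigma\in GSPP_\rho(S_3)$ and $\tau\in GSPP_\lambda(S_3)$ such that $S_3=\langle\sigma,\tau\rangle$.
   Context: $S_3$ is the group of permutations of $\{1,2,3\}$ under composition. For $\sigma\in S_3$ put $N_\lambda(\sigma)=1\,2\,3\,\sigma(3)\,\sigma(2)\,\sigma(1)$ and $N_\rho(\sigma)=1\,2\,3\,\sigma(1)\,\sigma(2)\,\sigma(3)$, six-digit numbers regarded as strings of digits. A string of digits is a generalized Smarandache palindrome (GSP) if it can be split into consecutive non-empty blocks so that it has the form $a_1a_2\cdots a_ka_k\cdots a_2a_1$ ($k\ge1$) or $a_1a_2\cdots a_{k-1}a_ka_{k-1}\cdots a_2a_1$ ($k\ge2$), where each block $a_i$ consists of one or more digits (the trivial splitting into a single block is excluded). $GSPP_\lambda(S_3)$ is the set of $\sigma\in S_3$ for which $N_\lambda(\sigma)$ is a GSP (left generalized Smarandache palindromic permutations), and $GSPP_\rho(S_3)$ is the set of $\sigma\in S_3$ for which $N_\rho(\sigma)$ is a GSP (right generalized Smarandache palindromic permutations). *)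

theory Defs
  imports "HOL-Algebra.Sym_Groups" "HOL-Algebra.Generated_Groups"
begin

text \<open>Strings of digits are lists of natural numbers, and a splitting into consecutive blocks is a
  list of lists of digits. Below, \<open>as\<close> is the list of blocks \<open>a\<^sub>1, \<dots>, a\<^sub>k\<close>. The two disjuncts are
  \<open>a\<^sub>1 \<dots> a\<^sub>k a\<^sub>k \<dots> a\<^sub>1\<close> with \<open>k \<ge> 1\<close> and \<open>a\<^sub>1 \<dots> a\<^sub>k\<^sub>-\<^sub>1 a\<^sub>k a\<^sub>k\<^sub>-\<^sub>1 \<dots> a\<^sub>1\<close> with \<open>k \<ge> 2\<close>; the bound
  \<open>k \<ge> 2\<close> rules out the trivial splitting into a single block.\<close>

definition generalized_smarandache_palindrome :: "nat list \<Rightarrow> bool" where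
  "generalized_smarandache_palindrome ds \<longleftrightarrow>
     (\<exists>as :: nat list list. [] \<notin> set as \<and>
        (length as \<ge> 1 \<and> ds = concat (as @ rev as) \<or>
         length as \<ge> 2 \<and> ds = concat (as @ rev (butlast as))))"

definition N_left :: "(nat \<Rightarrow> nat) \<Rightarrow> nat list" where
  "N_left \<sigma> = [1, 2, 3, \<sigma> 3, \<sigma> 2, \<sigma> 1]"

definition N_right :: "(nat \<Rightarrow> nat) \<Rightarrow> nat list" where
  "N_right \<sigma> = [1, 2, 3, \<sigma> 1, \<sigma> 2, \<sigma> 3]"

definition GSPP_left_S3 :: "(nat \<Rightarrow> nat) set" where
  "GSPP_left_S3 =
     {\<sigma> \<in> carrier (sym_group 3). generalized_smarandache_palindrome (N_left \<sigma>)}"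

definition GSPP_right_S3 :: "(nat \<Rightarrow> nat) set" where
  "GSPP_right_S3 =
     {\<sigma> \<in> carrier (sym_group 3). generalized_smarandache_palindrome (N_right \<sigma>)}"

end

theory Submission imports Defs begin

text \<open>The transposition exchanging \<open>1\<close> and \<open>3\<close> is right palindromic (\<open>123321\<close> splits as
  \<open>1|2332|1\<close>) and the one exchanging \<open>2\<close> and \<open>3\<close> is left palindromic (\<open>123231\<close> splits as
  \<open>1|2323|1\<close>). Every permutation of \<open>{1,2,3}\<close> is a transposition \<open>(1 b)\<close> after a permutation of
  \<open>{2,3}\<close>, and \<open>(1 2) = (1 3)(2 3)(1 3)\<close>, so these two transpositions generate \<open>S\<^sub>3\<close>.\<close>

text \<open>This is the odd form with k = 2: \<open>ys\<close> is the unrepeated middle block and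
  need not be a palindrome, so a long enough string with equal end digits qualifies.\<close>

lemma generalized_smarandache_palindrome_append:
  assumes "xs \<noteq> []" "ys \<noteq> []"
  shows "generalized_smarandache_palindrome (xs @ ys @ xs)"
  unfolding generalized_smarandache_palindrome_def
  using assms by (intro exI[of _ "[xs, ys]"]) auto

text \<open>Taking b = p 1, the factor \<open>transpose 1 b\<close> absorbs the image of 1; what
  remains fixes 1 and so permutes {2, 3}.\<close>

lemma permutes_1_to_3_cases:
  fixes p :: "nat \<Rightarrow> nat"
  assumes "p permutes {1..3}"
  obtains b q where "p = transpose 1 b \<circ> q" "b \<in> {1, 2, 3}" "q = id \<or> q = transpose 2 3"
proof -
  have "{1..3} = insert 1 {2, 3::nat}" by auto
  then have "p \<in> {p. p permutes insert 1 {2, 3}}" using assms by simp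
  then show thesis
    unfolding permutes_insert permutes_doubleton_iff using that by auto
qed

theorem lemma3p2:
  "\<exists>\<sigma> \<in> GSPP_right_S3. \<exists>\<tau> \<in> GSPP_left_S3.
     carrier (sym_group 3) = generate (sym_group 3) {\<sigma>, \<tau>}"
proof (intro bexI)
  let ?G = "sym_group 3" and ?s = "transpose 1 3 :: nat \<Rightarrow> nat" and ?t = "transpose 2 3 :: nat \<Rightarrow> nat"
  let ?H = "generate ?G {?s, ?t}"
  have s: "?s \<in> carrier ?G" and t: "?t \<in> carrier ?G"
    by (auto simp: sym_group_carrier intro!: permutes_swap_id)
  show "?s \<in> GSPP_right_S3"
    using s generalized_smarandache_palindrome_append[of "[1]" "[2, 3, 3, 2]"]
    by (simp add: GSPP_right_S3_def N_right_def transpose_def)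
  show "?t \<in> GSPP_left_S3"
    using t generalized_smarandache_palindrome_append[of "[1]" "[2, 3, 2, 3]"]
    by (simp add: GSPP_left_S3_def N_left_def transpose_def)
  show "carrier ?G = ?H"
  proof
    show "?H \<subseteq> carrier ?G"
      using s t by (intro group.generate_incl sym_group_is_group) auto
    have comp: "p \<circ> q \<in> ?H" if "p \<in> ?H" "q \<in> ?H" for p q
      using generate.eng[OF that] by (simp add: sym_group_mult)
    have id: "id \<in> ?H"
      using generate.one[of ?G] by (simp add: sym_group_one)
    have gens: "?s \<in> ?H" "?t \<in> ?H"
      by (auto intro: generate.incl)
    have "transpose 1 2 = ?s \<circ> ?t \<circ> ?s"
      by (auto simp: fun_eq_iff transpose_def)
    then have "transpose 1 2 \<in> ?H"
      by (simp only: comp gens)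
    \<comment> \<open>For b = 1 this is the identity, for b = 3 a generator.\<close>
    then have trans: "transpose 1 b \<in> ?H" if "b \<in> {1, 2, 3}" for b
      using that id gens by auto
    show "carrier ?G \<subseteq> ?H"
    proof
      fix p assume "p \<in> carrier ?G"
      then obtain b q where "p = transpose 1 b \<circ> q" "b \<in> {1, 2, 3}" "q = id \<or> q = ?t"
        unfolding sym_group_carrier by (rule permutes_1_to_3_cases)
      then show "p \<in> ?H"
        using comp[OF trans] id gens(2) by blast
    qed
  qed
qed

end
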